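(* Let $\varepsilon>0$ and let $L\subseteq\Sigma^*$ be a language in $\mathrm{2DFA}(2_s)$, i.e., $L$ is recognized by some two-head two-way deterministic finite automaton that has at least one supersafe head. Then $L$ has an interactive proof system with error bound $\varepsilon$ consisting of a constant-space prover (which may be taken to be classical or quantum) and a constant-space verifier. On every input, the verifier halts with probability at least $1-\varepsilon$ within expected polynomial time, and with the remaining probability it may fail to halt.
   Context: Input conventions: every machine reads the input $w$ on a read-only tape holding $\rhd w\lhd$, where $\rhd,\lhd$ are endmarkers. Two-head two-way deterministic finite automaton (2DFA(2)): a deterministic finite-state machine with two input heads $H_1,H_2$. Both heads start on the left endmarker. At each step, the current state and the pair of symbols scanned by the two heads determine the next state and a movement in $\{-1,0,1\}$ for each head separately. Supersafe head: head $H_i$ of a 2DFA(2) $M$ is supersafe if there is a one-head two-way deterministic finite automaton $N_i$ such that, for every input $w$: (1) $N_i$ halts on $w$, and its head follows a finite sequence $T_w$ of head positions; (2) suppose a single-head machine simulates $M$ on $w$ by moving its own head as $H_i$ moves, while the symbols read by the other head are supplied at each step arbitrarily (consistent with $w$ or not). Then the trajectory of the simulating head is always a prefix of $T_w$, and the simulation ends in a halting state of $M$. $\mathrm{2DFA}(2_s)$ denotes the class of languages recognized by 2DFA(2)'s that have at least one supersafe head. Verifier: a probabilistic Turing machine (with computable transition probabilities in $[0,1]$) augmented with a communication cell over a finite alphabet $\Gamma$, which it shares with a prover. Certain states are communicating states, each associated with a symbol of $\Gamma$; on entering such a state the verifier writes that symbol into the cell. The prover must respond by writing a symbol of $\Gamma$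 in its next step; if it does not, the verifier rejects. The verifier's next transition probabilities depend on the received symbol. The verifier halts on entering its accept or reject state. Provers: a classical prover is a probabilistic Turing machine that reads the same input and writes into the communication cell only in steps in which it detects a fresh verifier message. A constant-space quantum prover is a two-way finite automaton with quantum and classical states, i.e., a two-way DFA augmented with a constant-size quantum register acted on by unitaries or projective measurements, with computable amplitudes; it obeys the same communication convention. Interactive proof system with error bound $\varepsilon$ for $L$: a verifier $V$ and a prover $P$ such that: - for every $w\in L$, $V$ interacting with $P$ accepts with probability at least $1-\varepsilon$; - for every $w\notin L$ and every prover $P^*$, $V$ interacting with $P^*$ rejects with probability at least $1-\varepsilon$ (so it accepts or runs forever with probability at most $\varepsilon$). *)

theory Defs
  imports
    "HOL-Probability.Probability_Mass_Function"
    "HOL-Computational_Algebra.Polynomial"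
    "HOL-Library.Sublist"
    "Jordan_Normal_Form.Schur_Decomposition"
begin

datatype 'a tsym = LEnd | REnd | Sym 'a

text \<open>The tape holds the left endmarker at position 0, the letters of the input
  at positions 1 to n, and the right endmarker at position n + 1.  Well-formed machines never leave
  this range, so the values of \<open>scan\<close> elsewhere are irrelevant.\<close>

definition scan :: "'a list \<Rightarrow> int \<Rightarrow> 'a tsym" where
  "scan w p = (if p \<le> 0 then LEnd
               else if p \<le> int (length w) then Sym (w ! nat (p - 1)) else REnd)"

definition legal_move :: "'a tsym \<Rightarrow> int \<Rightarrow> bool" where
  "legal_move x d \<longleftrightarrow> d \<in> {-1, 0, 1} \<and> (x = LEnd \<longrightarrow> d \<noteq> -1) \<and> (x = REnd \<longrightarrow> d \<noteq> 1)"

text \<open>The heads are indexed by the type \<open>'h\<close>: \<open>bool\<close> for two heads, \<open>unit\<close> for one head.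
  States are the natural numbers below \<open>nstates\<close>.\<close>

record ('h, 'a) mhdfa =
  nstates :: nat
  start :: nat
  accepting :: "nat set"
  rejecting :: "nat set"
  delta :: "nat \<Rightarrow> ('h \<Rightarrow> 'a tsym) \<Rightarrow> nat \<times> ('h \<Rightarrow> int)"

definition wf_mhdfa :: "('h, 'a) mhdfa \<Rightarrow> bool" where
  "wf_mhdfa M \<longleftrightarrow>
     start M < nstates M \<and>
     accepting M \<subseteq> {..<nstates M} \<and> rejecting M \<subseteq> {..<nstates M} \<and>
     accepting M \<inter> rejecting M = {} \<and>
     (\<forall>q<nstates M. \<forall>x. fst (delta M q x) < nstates M \<and>
                        (\<forall>h. legal_move (x h) (snd (delta M q x) h)))"

definition halting :: "('h, 'a) mhdfa \<Rightarrow> nat set" where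
  "halting M = accepting M \<union> rejecting M"

text \<open>Configurations are frozen once a halting state is reached.\<close>

definition mh_step ::
    "('h, 'a) mhdfa \<Rightarrow> 'a list \<Rightarrow> nat \<times> ('h \<Rightarrow> int) \<Rightarrow> nat \<times> ('h \<Rightarrow> int)" where
  "mh_step M w = (\<lambda>(q, pos).
     if q \<in> halting M then (q, pos)
     else let (q', d) = delta M q (\<lambda>h. scan w (pos h)) in (q', \<lambda>h. pos h + d h))"

definition mh_run :: "('h, 'a) mhdfa \<Rightarrow> 'a list \<Rightarrow> nat \<Rightarrow> nat \<times> ('h \<Rightarrow> int)" where
  "mh_run M w t = (mh_step M w ^^ t) (start M, \<lambda>_. 0)"

definition mh_accepts :: "('h, 'a) mhdfa \<Rightarrow> 'a list \<Rightarrow> bool" where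
  "mh_accepts M w \<longleftrightarrow> (\<exists>t. fst (mh_run M w t) \<in> accepting M)"

definition first_time :: "(nat \<Rightarrow> bool) \<Rightarrow> nat \<Rightarrow> bool" where
  "first_time Q t \<longleftrightarrow> Q t \<and> (\<forall>t'<t. \<not> Q t')"

text \<open>The single-head simulation of \<open>M\<close> by head \<open>i\<close>: in step \<open>t\<close> every other head
  reads the supplied symbol \<open>s t\<close>, which need not occur on the tape.\<close>

fun sim_run ::
    "('h, 'a) mhdfa \<Rightarrow> 'h \<Rightarrow> 'a list \<Rightarrow> (nat \<Rightarrow> 'a tsym) \<Rightarrow> nat \<Rightarrow> nat \<times> int" where
  "sim_run M i w s 0 = (start M, 0)"
| "sim_run M i w s (Suc t) =
     (let (q, p) = sim_run M i w s t in
      if q \<in> halting M then (q, p)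
      else let (q', d) = delta M q (\<lambda>h. if h = i then scan w p else s t) in (q', p + d i))"

definition supersafe :: "(bool, 'a) mhdfa \<Rightarrow> bool \<Rightarrow> bool" where
  "supersafe M i \<longleftrightarrow>
     (\<exists>N :: (unit, 'a) mhdfa. wf_mhdfa N \<and>
        (\<forall>w. \<exists>n. first_time (\<lambda>t. fst (mh_run N w t) \<in> halting N) n \<and>
           (\<forall>s. \<exists>m. first_time (\<lambda>t. fst (sim_run M i w s t) \<in> halting M) m \<and>
                prefix (map (\<lambda>t. snd (sim_run M i w s t)) [0..<Suc m])
                       (map (\<lambda>t. snd (mh_run N w t) ()) [0..<Suc n]))))"

definition TwoDFA2s :: "'a list set set" where
  "TwoDFA2s = {L. \<exists>M :: (bool, 'a) mhdfa. wf_mhdfa M \<and> (\<exists>i. supersafe M i) \<and>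
                   L = {w. mh_accepts M w}}"

text \<open>Total recursive functions, with minimisation restricted to regular functions.
  Only the values on lists of length \<open>n\<close> are meaningful for \<open>recursive_fn n f\<close>.\<close>

inductive recursive_fn :: "nat \<Rightarrow> (nat list \<Rightarrow> nat) \<Rightarrow> bool" where
  zero: "recursive_fn n (\<lambda>_. 0)"
| succ: "recursive_fn 1 (\<lambda>xs. Suc (xs ! 0))"
| proj: "i < n \<Longrightarrow> recursive_fn n (\<lambda>xs. xs ! i)"
| comp: "recursive_fn (length gs) f \<Longrightarrow> (\<And>g. g \<in> set gs \<Longrightarrow> recursive_fn n g) \<Longrightarrow>
         recursive_fn n (\<lambda>xs. f (map (\<lambda>g. g xs) gs))"
| prim: "recursive_fn n f \<Longrightarrow> recursive_fn (Suc (Suc n)) g \<Longrightarrow>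
         recursive_fn (Suc n)
           (\<lambda>xs. rec_nat (f (tl xs)) (\<lambda>k r. g (k # r # tl xs)) (hd xs))"
| mini: "recursive_fn (Suc n) f \<Longrightarrow> (\<And>xs. length xs = n \<Longrightarrow> \<exists>k. f (k # xs) = 0) \<Longrightarrow>
         recursive_fn n (\<lambda>xs. LEAST k. f (k # xs) = 0)"

definition computable_fn :: "(nat \<Rightarrow> nat) \<Rightarrow> bool" where
  "computable_fn f \<longleftrightarrow> (\<exists>g. recursive_fn 1 g \<and> (\<forall>n. f n = g [n]))"

definition computable_real :: "real \<Rightarrow> bool" where
  "computable_real x \<longleftrightarrow>
     (\<exists>a b c. computable_fn a \<and> computable_fn b \<and> computable_fn c \<and>
        (\<forall>n. \<bar>x - (real (a n) - real (b n)) / (real (c n) + 1)\<bar> \<le> (1 / 2) ^ n))"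

definition computable_mat :: "complex mat \<Rightarrow> bool" where
  "computable_mat A \<longleftrightarrow>
     (\<forall>i<dim_row A. \<forall>j<dim_col A. computable_real (Re (A $$ (i, j))) \<and>
                                   computable_real (Im (A $$ (i, j))))"

text \<open>States and work symbols are the natural numbers below \<open>pstates\<close> and \<open>psyms\<close>; work symbol
  0 is the blank and the work tape is two-way infinite.  The communication alphabet is
  \<open>{..<G}\<close> for some \<open>G\<close>.  The fourth argument of \<open>ptrans\<close> is the
  symbol newly received through the communication cell, if any.  The outcome of a transition
  is the new state, the work symbol written, the moves of the input and the work head, and
  an output in \<open>'o\<close>: for a prover the symbol written into the cell, if any; a verifier
  writes by entering a communicating state, so there \<open>'o\<close> is \<open>unit\<close>.\<close>

record ('a, 'o) ptm =
  pstates :: nat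
  psyms :: nat
  pstart :: nat
  ptrans :: "nat \<Rightarrow> 'a tsym \<Rightarrow> nat \<Rightarrow> nat option \<Rightarrow> (nat \<times> nat \<times> int \<times> int \<times> 'o) pmf"

definition wf_ptm :: "nat \<Rightarrow> ('a, 'o) ptm \<Rightarrow> bool" where
  "wf_ptm G T \<longleftrightarrow>
     pstart T < pstates T \<and> 0 < psyms T \<and>
     (\<forall>q x s m. q < pstates T \<longrightarrow> s < psyms T \<longrightarrow> set_option m \<subseteq> {..<G} \<longrightarrow>
        (\<forall>(q', s', d, e, u) \<in> set_pmf (ptrans T q x s m).
            q' < pstates T \<and> s' < psyms T \<and> legal_move x d \<and> e \<in> {-1, 0, 1}) \<and>
        (\<forall>a. computable_real (pmf (ptrans T q x s m) a)))"

text \<open>State, input head, work head, work tape.\<close>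

type_synonym pconf = "nat \<times> int \<times> int \<times> (int \<Rightarrow> nat)"

definition ptm_init :: "('a, 'o) ptm \<Rightarrow> pconf" where
  "ptm_init T = (pstart T, 0, 0, \<lambda>_. 0)"

definition ptm_step ::
    "('a, 'o) ptm \<Rightarrow> 'a list \<Rightarrow> nat option \<Rightarrow> pconf \<Rightarrow> (pconf \<times> 'o) pmf" where
  "ptm_step T w m = (\<lambda>(q, i, j, tape).
     map_pmf (\<lambda>(q', s', d, e, u). ((q', i + d, j + e, tape(j := s')), u))
       (ptrans T q (scan w i) (tape j) m))"

text \<open>\<open>A q m\<close> states that in state \<open>q\<close> the machine may be faced with the cell content \<open>m\<close>.\<close>

inductive_set ptm_reach ::
    "('a, 'o) ptm \<Rightarrow> (nat \<Rightarrow> nat option \<Rightarrow> bool) \<Rightarrow> 'a list \<Rightarrow> pconf set"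
  for T A w where
  "ptm_init T \<in> ptm_reach T A w"
| "c \<in> ptm_reach T A w \<Longrightarrow> A (fst c) m \<Longrightarrow> (c', u) \<in> set_pmf (ptm_step T w m c) \<Longrightarrow>
   c' \<in> ptm_reach T A w"

definition constant_space_ptm ::
    "('a, 'o) ptm \<Rightarrow> (nat \<Rightarrow> nat option \<Rightarrow> bool) \<Rightarrow> bool" where
  "constant_space_ptm T A \<longleftrightarrow>
     (\<exists>b. \<forall>w. \<forall>(q, i, j, tape) \<in> ptm_reach T A w. \<bar>j\<bar> \<le> b)"

text \<open>\<open>message V q\<close> is the symbol associated with \<open>q\<close> if \<open>q\<close> is a communicating state, and
  \<open>None\<close> otherwise.\<close>

record 'a verifier = "('a, unit) ptm" +
  gamma :: nat
  message :: "nat \<Rightarrow> nat option"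
  accept :: nat
  reject :: nat

definition wf_verifier :: "'a verifier \<Rightarrow> bool" where
  "wf_verifier V \<longleftrightarrow>
     wf_ptm (gamma V) (ptm.truncate V) \<and>
     accept V < pstates V \<and> reject V < pstates V \<and> accept V \<noteq> reject V \<and>
     (\<forall>q<pstates V. set_option (message V q) \<subseteq> {..<gamma V})"

definition halted :: "'a verifier \<Rightarrow> pconf \<Rightarrow> bool" where
  "halted V c \<longleftrightarrow> fst c \<in> {accept V, reject V}"

definition constant_space_verifier :: "'a verifier \<Rightarrow> bool" where
  "constant_space_verifier V \<longleftrightarrow>
     constant_space_ptm (ptm.truncate V)
       (\<lambda>q m. q \<notin> {accept V, reject V} \<and> set_option m \<subseteq> {..<gamma V} \<and>
              (m = None \<longleftrightarrow> message V q = None))"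

datatype qop = Unitary "complex mat" | Measure "complex mat list"

text \<open>In each step \<open>qop_of\<close> chooses a unitary or a projective measurement, which
  is applied to the register; the outcome (an index into the list of projections, or 0 for a
  unitary) is the last argument of \<open>qtrans\<close>, which gives the new classical
  state, the head move, and the symbol written into the communication cell, if any.\<close>

record 'a qfa =
  qstates :: nat
  qstart :: nat
  qdim :: nat
  qop_of :: "nat \<Rightarrow> 'a tsym \<Rightarrow> nat option \<Rightarrow> qop"
  qtrans :: "nat \<Rightarrow> 'a tsym \<Rightarrow> nat option \<Rightarrow> nat \<Rightarrow> nat \<times> int \<times> nat option"

fun wf_qop :: "nat \<Rightarrow> qop \<Rightarrow> bool" where
  "wf_qop d (Unitary U) \<longleftrightarrow>
     U \<in> carrier_mat d d \<and> U * mat_adjoint U = 1\<^sub>m d \<and> computable_mat U"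
| "wf_qop d (Measure Ps) \<longleftrightarrow>
     (\<forall>P \<in> set Ps. P \<in> carrier_mat d d \<and> P * P = P \<and> mat_adjoint P = P \<and> computable_mat P) \<and>
     (\<forall>k<length Ps. \<forall>l<length Ps. k \<noteq> l \<longrightarrow> Ps ! k * Ps ! l = 0\<^sub>m d d) \<and>
     foldr (+) Ps (0\<^sub>m d d) = 1\<^sub>m d"

fun outcomes :: "qop \<Rightarrow> nat set" where
  "outcomes (Unitary U) = {0}"
| "outcomes (Measure Ps) = {..<length Ps}"

definition qwrites :: "nat \<Rightarrow> nat option \<Rightarrow> nat option \<Rightarrow> bool" where
  "qwrites G m r \<longleftrightarrow> set_option r \<subseteq> {..<G} \<and> (m = None \<longrightarrow> r = None)"

definition wf_qfa :: "nat \<Rightarrow> 'a qfa \<Rightarrow> bool" where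
  "wf_qfa G Q \<longleftrightarrow>
     qstart Q < qstates Q \<and> 0 < qdim Q \<and>
     (\<forall>q x m. q < qstates Q \<longrightarrow> set_option m \<subseteq> {..<G} \<longrightarrow>
        wf_qop (qdim Q) (qop_of Q q x m) \<and>
        (\<forall>k \<in> outcomes (qop_of Q q x m).
           case qtrans Q q x m k of (q', d, r) \<Rightarrow>
             q' < qstates Q \<and> legal_move x d \<and> qwrites G m r))"

definition born :: "complex vec \<Rightarrow> complex mat \<Rightarrow> real" where
  "born \<psi> P = Re ((P *\<^sub>v \<psi>) \<bullet>c (P *\<^sub>v \<psi>))"

text \<open>The argument of \<open>embed_pmf\<close> sums to 1 whenever \<open>\<psi>\<close> is a unit vector and the
  operation is well-formed.\<close>

fun apply_qop :: "qop \<Rightarrow> complex vec \<Rightarrow> (nat \<times> complex vec) pmf" where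
  "apply_qop (Unitary U) \<psi> = return_pmf (0, U *\<^sub>v \<psi>)"
| "apply_qop (Measure Ps) \<psi> =
     map_pmf (\<lambda>k. (k, complex_of_real (1 / sqrt (born \<psi> (Ps ! k))) \<cdot>\<^sub>v (Ps ! k *\<^sub>v \<psi>)))
       (embed_pmf (\<lambda>k. if k < length Ps then born \<psi> (Ps ! k) else 0))"

text \<open>State, input head, register.\<close>

type_synonym qconf = "nat \<times> int \<times> complex vec"

definition qfa_init :: "'a qfa \<Rightarrow> qconf" where
  "qfa_init Q = (qstart Q, 0, unit_vec (qdim Q) 0)"

definition qfa_step ::
    "'a qfa \<Rightarrow> 'a list \<Rightarrow> nat option \<Rightarrow> qconf \<Rightarrow> (qconf \<times> nat option) pmf" where
  "qfa_step Q w m = (\<lambda>(q, i, \<psi>).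
     map_pmf (\<lambda>(k, \<psi>'). case qtrans Q q (scan w i) m k of (q', d, r) \<Rightarrow> ((q', i + d, \<psi>'), r))
       (apply_qop (qop_of Q q (scan w i) m) \<psi>))"

datatype 'a prover = Classical "('a, nat option) ptm" | Quantum "'a qfa"

fun wf_prover :: "nat \<Rightarrow> 'a prover \<Rightarrow> bool" where
  "wf_prover G (Classical T) \<longleftrightarrow>
     wf_ptm G T \<and>
     (\<forall>q x s m. q < pstates T \<longrightarrow> s < psyms T \<longrightarrow> set_option m \<subseteq> {..<G} \<longrightarrow>
        (\<forall>(q', s', d, e, r) \<in> set_pmf (ptrans T q x s m). qwrites G m r))"
| "wf_prover G (Quantum Q) \<longleftrightarrow> wf_qfa G Q"

fun constant_space_prover :: "nat \<Rightarrow> 'a prover \<Rightarrow> bool" where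
  "constant_space_prover G (Classical T) \<longleftrightarrow>
     constant_space_ptm T (\<lambda>q m. set_option m \<subseteq> {..<G})"
| "constant_space_prover G (Quantum Q) \<longleftrightarrow> True"

fun prover_init :: "'a prover \<Rightarrow> pconf + qconf" where
  "prover_init (Classical T) = Inl (ptm_init T)"
| "prover_init (Quantum Q) = Inr (qfa_init Q)"

fun prover_step ::
    "'a prover \<Rightarrow> 'a list \<Rightarrow> nat option \<Rightarrow> pconf + qconf \<Rightarrow> ((pconf + qconf) \<times> nat option) pmf"
where
  "prover_step (Classical T) w m (Inl c) = map_pmf (apfst Inl) (ptm_step T w m c)"
| "prover_step (Quantum Q) w m (Inr c) = map_pmf (apfst Inr) (qfa_step Q w m c)"
| "prover_step _ w m c = return_pmf (c, None)"  \<comment> \<open>mismatched configuration, never reached\<close>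

type_synonym iconf = "pconf \<times> (pconf + qconf)"

text \<open>Both machines run in lockstep.  In each step the prover moves first, seeing the
  message of the verifier's current state (if that state is communicating); then
  the verifier moves, seeing the response.  An unanswered message makes the verifier reject.\<close>

definition istep :: "'a verifier \<Rightarrow> 'a prover \<Rightarrow> 'a list \<Rightarrow> iconf \<Rightarrow> iconf pmf" where
  "istep V P w = (\<lambda>(c, s).
     if halted V c then return_pmf (c, s)
     else let m = message V (fst c) in
       bind_pmf (prover_step P w m s) (\<lambda>(s', r).
         if m \<noteq> None \<and> r = None then return_pmf ((reject V, snd c), s')
         else map_pmf (\<lambda>(c', _). (c', s'))
                (ptm_step (ptm.truncate V) w (if m = None then None else r) c)))"

text \<open>The distribution of the first \<open>n + 1\<close> configurations of the interaction.\<close>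

fun history :: "'a verifier \<Rightarrow> 'a prover \<Rightarrow> 'a list \<Rightarrow> nat \<Rightarrow> iconf list pmf" where
  "history V P w 0 = return_pmf [(ptm_init (ptm.truncate V), prover_init P)]"
| "history V P w (Suc n) =
     bind_pmf (history V P w n) (\<lambda>cs. map_pmf (\<lambda>c. cs @ [c]) (istep V P w (last cs)))"

definition accept_prob :: "'a verifier \<Rightarrow> 'a prover \<Rightarrow> 'a list \<Rightarrow> real" where
  "accept_prob V P w =
     (SUP n. measure_pmf.prob (history V P w n) {cs. fst (fst (last cs)) = accept V})"

definition reject_prob :: "'a verifier \<Rightarrow> 'a prover \<Rightarrow> 'a list \<Rightarrow> real" where
  "reject_prob V P w =
     (SUP n. measure_pmf.prob (history V P w n) {cs. fst (fst (last cs)) = reject V})"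

definition interactive_proof_system ::
    "'a verifier \<Rightarrow> 'a prover \<Rightarrow> 'a list set \<Rightarrow> real \<Rightarrow> bool" where
  "interactive_proof_system V P L \<epsilon> \<longleftrightarrow>
     wf_verifier V \<and> wf_prover (gamma V) P \<and>
     (\<forall>w \<in> L. accept_prob V P w \<ge> 1 - \<epsilon>) \<and>
     (\<forall>w. w \<notin> L \<longrightarrow> (\<forall>P'. wf_prover (gamma V) P' \<longrightarrow> reject_prob V P' w \<ge> 1 - \<epsilon>))"

text \<open>The probability that the verifier halts after exactly \<open>t\<close> steps and the event \<open>E\<close> occurs,
  where \<open>E\<close> is a set of halting histories.\<close>

definition halt_prob_at ::
    "'a verifier \<Rightarrow> 'a prover \<Rightarrow> 'a list \<Rightarrow> iconf list set \<Rightarrow> nat \<Rightarrow> real" where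
  "halt_prob_at V P w E t =
     measure_pmf.prob (history V P w t)
       {cs \<in> E. halted V (fst (last cs)) \<and> (\<forall>c \<in> set (butlast cs). \<not> halted V (fst c))}"

text \<open>There is an event of probability at least \<open>p\<close> on which the verifier
  halts, and conditioned on which the expected halting time is at most \<open>b\<close>.\<close>

definition halts_within_expected ::
    "'a verifier \<Rightarrow> 'a prover \<Rightarrow> 'a list \<Rightarrow> real \<Rightarrow> real \<Rightarrow> bool" where
  "halts_within_expected V P w p b \<longleftrightarrow>
     (\<exists>E a e. halt_prob_at V P w E sums a \<and>
              (\<lambda>t. real t * halt_prob_at V P w E t) sums e \<and>
              a \<ge> p \<and> e \<le> b * a)"

end

theory Submission
  imports Defs
begin

text \<open>Let head \<open>i\<close> of \<open>M\<close> be supersafe with guide \<open>N\<close>.  The prover just runs \<open>N\<close> over and over and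
  sends the symbols it reads, which while \<open>M\<close> runs are those scanned by head \<open>i\<close>.  In each round
  the verifier secretly tosses a coin of bias \<open>p \<le> \<epsilon>\<close>.  With probability \<open>p\<close> it simulates \<open>M\<close>,
  moving as the other head and taking the symbols of head \<open>i\<close> from the prover, and answers as \<open>M\<close>
  does; otherwise it runs \<open>N\<close> itself, rejects if a symbol is wrong, and goes on to the next round.
  A prover that never lies makes the simulation end with the right answer; a prover that lies in
  some round gains only if that round is a simulation.  If \<open>\<beta>\<close> bounds the probability of failure
  after \<open>k\<close> more rounds, then \<open>max p ((1 - p) * \<beta>)\<close> bounds it after \<open>k + 1\<close>, which yields
  \<open>max p ((1 - p) ^ k)\<close> after \<open>k\<close> rounds of linear length each.\<close>

section \<open>Computable constants\<close>

lemma recursive_fn_const: "recursive_fn n (\<lambda>_. c)"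
proof (induction c)
  case 0
  show ?case by (rule recursive_fn.zero)
next
  case (Suc c)
  have "recursive_fn n (\<lambda>xs. (\<lambda>ys. Suc (ys ! 0)) (map (\<lambda>g. g xs) [\<lambda>_. c]))"
    by (rule recursive_fn.comp) (use Suc recursive_fn.succ in auto)
  then show ?case by simp
qed

lemma computable_fn_const: "computable_fn (\<lambda>_. c)"
  unfolding computable_fn_def by (rule exI[of _ "\<lambda>_. c"]) (simp add: recursive_fn_const)

lemma computable_real_frac: "computable_real ((real a - real b) / (real c + 1))"
  unfolding computable_real_def
  by (rule exI[of _ "\<lambda>_. a"], rule exI[of _ "\<lambda>_. b"], rule exI[of _ "\<lambda>_. c"])
    (simp add: computable_fn_const)

lemma computable_real_0: "computable_real 0" and computable_real_1: "computable_real 1"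
  using computable_real_frac[of 0 0 0] computable_real_frac[of 1 0 0] by simp_all

text \<open>A step of the verifier may send both sides of the coin to one outcome, so an outcome has
  the probability of its preimage in \<open>bool\<close>: 0, \<open>p\<close>, \<open>1 - p\<close>
  or 1. All four are rational because the bias is \<open>1 / (d + 1)\<close>.\<close>

lemma computable_real_pmf_bernoulli:
  fixes d :: nat
  defines "p \<equiv> 1 / (real d + 1)"
  shows "computable_real (pmf (map_pmf f (bernoulli_pmf p)) a)"
proof -
  have p: "0 \<le> p" "p \<le> 1" by (auto simp: p_def)
  have cp: "computable_real p" using computable_real_frac[of 1 0 d] by (simp add: p_def)
  have cq: "computable_real (1 - p)"
    using computable_real_frac[of d 0 d] by (simp add: p_def field_simps)
  have single: "measure (bernoulli_pmf p) {True} = p" "measure (bernoulli_pmf p) {False} = 1 - p"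
    using p by (simp_all add: measure_pmf_single)
  have "f -` {a} \<in> Pow {False, True}" by auto
  then consider "f -` {a} = {}" | "f -` {a} = {True}" | "f -` {a} = {False}" | "f -` {a} = UNIV"
    unfolding Pow_insert by (auto simp: UNIV_bool)
  then have "computable_real (measure (bernoulli_pmf p) (f -` {a}))"
    by cases (simp_all only: single cp cq measure_empty measure_pmf_UNIV
        computable_real_0 computable_real_1)
  then show ?thesis by (simp only: pmf_map)
qed

section \<open>Runs of multi-head automata\<close>

lemma mh_run_Suc: "mh_run M w (Suc t) = mh_step M w (mh_run M w t)"
  by (simp add: mh_run_def)

lemma mh_run_0 [simp]: "mh_run M w 0 = (start M, \<lambda>_. 0)"
  by (simp add: mh_run_def)

lemma legal_move_in_tape:
  assumes "legal_move (scan w x) e" "0 \<le> x" "x \<le> int (length w) + 1"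
  shows "0 \<le> x + e \<and> x + e \<le> int (length w) + 1"
  using assms by (auto simp: legal_move_def scan_def split: if_splits)

lemma mh_run_bounds:
  assumes "wf_mhdfa M"
  shows "fst (mh_run M w t) < nstates M \<and>
    (\<forall>h. 0 \<le> snd (mh_run M w t) h \<and> snd (mh_run M w t) h \<le> int (length w) + 1)"
proof (induction t)
  case 0
  then show ?case using assms by (simp add: wf_mhdfa_def)
next
  case (Suc t)
  obtain q pos where qp: "mh_run M w t = (q, pos)" by fastforce
  obtain q' e where e: "delta M q (\<lambda>h. scan w (pos h)) = (q', e)" by fastforce
  have "q' < nstates M" "\<And>h. legal_move (scan w (pos h)) (e h)"
    using assms Suc qp e unfolding wf_mhdfa_def by (metis fst_conv, metis fst_conv snd_conv)
  then show ?case
    using Suc qp e legal_move_in_tape[of w "pos h" "e h" for h]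
    by (simp add: mh_run_Suc mh_step_def)
qed

lemma mh_run_frozen:
  assumes "fst (mh_run M w m) \<in> halting M" "m \<le> t"
  shows "mh_run M w t = mh_run M w m"
  using assms(2)
proof (induction t rule: dec_induct)
  case (step t)
  then show ?case using assms(1) by (cases "mh_run M w m") (simp add: mh_run_Suc mh_step_def)
qed simp

lemma mh_run_shift:
  assumes "mh_run M w a = mh_run M w b"
  shows "mh_run M w (a + k) = mh_run M w (b + k)"
  by (induction k) (simp_all add: assms mh_run_Suc)

text \<open>Pigeonhole on pairs of state and head position: if the configurations at times
  \<open>a < b \<le> n\<close> were equal, determinism would bring halting forward from
  \<open>n\<close> to \<open>a + (n - b)\<close>. This makes the length of a round linear.\<close>

lemma halting_time_bound:
  fixes N :: "(unit, 'a) mhdfa"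
  assumes wf: "wf_mhdfa N" and n: "first_time (\<lambda>t. fst (mh_run N w t) \<in> halting N) n"
  shows "n \<le> nstates N * (length w + 2)"
proof -
  let ?f = "\<lambda>t. (fst (mh_run N w t), nat (snd (mh_run N w t) ()))"
  have ne: False if ab: "a < b" "b \<le> n" "?f a = ?f b" for a b
  proof -
    have "snd (mh_run N w a) () = snd (mh_run N w b) ()"
      using ab mh_run_bounds[OF wf, of w a] mh_run_bounds[OF wf, of w b]
      by (metis eq_nat_nat_iff snd_conv)
    then have "mh_run N w a = mh_run N w b"
      using ab by (auto simp: prod_eq_iff)
    then have "mh_run N w (a + (n - b)) = mh_run N w (b + (n - b))" by (rule mh_run_shift)
    then have "fst (mh_run N w (a + (n - b))) \<in> halting N"
      using ab n by (simp add: first_time_def)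
    moreover have "a + (n - b) < n" using ab by simp
    ultimately show False using n by (auto simp: first_time_def)
  qed
  have "inj_on ?f {..n}"
    by (rule inj_onI, rule ccontr) (metis atMost_iff ne nat_neq_iff)
  moreover have "?f ` {..n} \<subseteq> {..<nstates N} \<times> {..<length w + 2}"
    using mh_run_bounds[OF wf, of w]
    by (auto simp: nat_less_iff) (smt (verit))
  ultimately have "card {..n} \<le> card ({..<nstates N} \<times> {..<length w + 2})"
    by (intro card_inj_on_le) auto
  then show ?thesis by simp
qed

lemma mh_accepts_iff_halting_state:
  assumes wf: "wf_mhdfa M" and m: "fst (mh_run M w m) \<in> halting M"
  shows "mh_accepts M w \<longleftrightarrow> fst (mh_run M w m) \<in> accepting M"
proof
  assume "mh_accepts M w"
  then obtain t where t: "fst (mh_run M w t) \<in> accepting M" by (auto simp: mh_accepts_def)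
  then have "fst (mh_run M w t) \<in> halting M" by (simp add: halting_def)
  then have "mh_run M w t = mh_run M w m"
    using mh_run_frozen[OF m, of t] mh_run_frozen[of M w t m] by (metis linear)
  then show "fst (mh_run M w m) \<in> accepting M" using t by simp
qed (auto simp: mh_accepts_def)

lemma two_heads: "(\<lambda>h. if h = i then f (g i) else f (g (\<not> i))) = (\<lambda>h. f (g h))"
proof
  show "(if h = i then f (g i) else f (g (\<not> i))) = f (g h)" for h
    by (cases h; cases i) auto
qed

text \<open>Links the simulations that supersafety speaks of with actual runs of \<open>M\<close>:
  the supplied symbols are those that the other head really reads.\<close>

lemma sim_run_truthful:
  fixes M :: "(bool, 'a) mhdfa"
  shows "sim_run M i w (\<lambda>t. scan w (snd (mh_run M w t) (\<not> i))) t
    = (fst (mh_run M w t), snd (mh_run M w t) i)"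
proof (induction t)
  case (Suc t)
  obtain q pos where qp: "mh_run M w t = (q, pos)" by fastforce
  have "delta M q (\<lambda>h. if h = i then scan w (pos i) else scan w (snd (mh_run M w t) (\<not> i)))
      = delta M q (\<lambda>h. scan w (pos h))" 
    by (simp only: qp snd_conv two_heads)
  then show ?case using Suc qp by (simp add: mh_run_Suc mh_step_def split: prod.splits)
qed simp

section \<open>Histories\<close>

text \<open>Unfolds from the first step, while \<open>history\<close> grows at the end; first-step
  analysis of the failure probability needs the former.\<close>

primrec run :: "'a verifier \<Rightarrow> 'a prover \<Rightarrow> 'a list \<Rightarrow> nat \<Rightarrow> iconf \<Rightarrow> iconf pmf" where
  "run V P w 0 c = return_pmf c"
| "run V P w (Suc n) c = bind_pmf (istep V P w c) (run V P w n)"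

lemma run_bind_istep: "bind_pmf (run V P w n c) (istep V P w) = run V P w (Suc n) c"
proof (induction n arbitrary: c)
  case 0
  have "run V P w 0 = return_pmf" by (simp add: fun_eq_iff)
  then show ?case by (simp add: bind_return_pmf bind_return_pmf')
next
  case (Suc n)
  have "bind_pmf (run V P w (Suc n) c) (istep V P w)
      = bind_pmf (istep V P w c) (\<lambda>x. bind_pmf (run V P w n x) (istep V P w))"
    by (simp add: bind_assoc_pmf)
  also have "\<dots> = bind_pmf (istep V P w c) (run V P w (Suc n))"
    unfolding Suc ..
  finally show ?case by simp
qed

lemma map_last_history:
  "map_pmf last (history V P w n) = run V P w n (ptm_init (ptm.truncate V), prover_init P)"
proof (induction n)
  case (Suc n)
  have "map_pmf last (history V P w (Suc n))
      = bind_pmf (map_pmf last (history V P w n)) (istep V P w)"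
    by (simp add: map_bind_pmf bind_map_pmf map_pmf_comp)
  then show ?case using Suc run_bind_istep by metis
qed simp

lemma prob_history_last:
  "measure_pmf.prob (history V P w n) {cs. Q (last cs)}
   = measure_pmf.prob (run V P w n (ptm_init (ptm.truncate V), prover_init P)) {c. Q c}"
  by (simp flip: map_last_history add: vimage_def)

lemma length_history: "cs \<in> set_pmf (history V P w n) \<Longrightarrow> length cs = Suc n"
  by (induction n arbitrary: cs) auto

text \<open>Consistency of the distributions: halting events at different times can be moved into
  the single space of histories up to \<open>T\<close> and added there.\<close>

lemma map_take_history:
  "t \<le> n \<Longrightarrow> map_pmf (take (Suc t)) (history V P w n) = history V P w t"
proof (induction n rule: dec_induct)
  case base
  show ?case
    using map_pmf_cong[OF refl, of "history V P w t" "take (Suc t)" "\<lambda>x. x"]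
      length_history[of _ V P w t] by (simp add: map_pmf_ident)
next
  case (step n)
  have "map_pmf (take (Suc t)) (history V P w (Suc n))
    = bind_pmf (history V P w n) (\<lambda>cs. return_pmf (take (Suc t) cs))"
    unfolding history.simps map_bind_pmf
    by (rule bind_pmf_cong) (use length_history[of _ V P w n] step in \<open>auto simp: map_pmf_comp map_pmf_const\<close>)
  then show ?case using step by (simp flip: map_pmf_def)
qed

text \<open>Truncating the event at a deadline \<open>T\<close> makes the bound on the conditional expectation trivial.\<close>

lemma halts_within_expected_deadline:
  assumes "measure_pmf.prob (history V P w T) {cs. halted V (fst (last cs))} \<ge> p"
  shows "halts_within_expected V P w p (real T)"
proof -
  define E where "E = {cs :: iconf list. length cs \<le> Suc T}"
  define h where "h = halt_prob_at V P w E"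
  define D where "D = {cs :: iconf list. halted V (fst (last cs)) \<and>
    (\<forall>c \<in> set (butlast cs). \<not> halted V (fst c))}"
  have h0: "h t \<ge> 0" for t by (simp add: h_def halt_prob_at_def)
  have late: "h t = 0" if "t \<notin> {..T}" for t
    unfolding h_def halt_prob_at_def measure_pmf_zero_iff
    using that length_history[of _ V P w t] by (fastforce simp: E_def)
  have early: "h t = measure_pmf.prob (history V P w T) {cs. take (Suc t) cs \<in> D}"
    if "t \<le> T" for t
  proof -
    have "h t = measure_pmf.prob (history V P w t) D"
      unfolding h_def halt_prob_at_def
      by (rule measure_prob_cong_0; rule pmf_eq_0_set_pmf[THEN iffD2])
        (use that length_history[of _ V P w t] in \<open>auto simp: E_def D_def\<close>)
    then show ?thesis
      by (simp flip: map_take_history[OF that] add: vimage_def)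
  qed
  \<comment> \<open>A history that is halted at \<open>T\<close> has a first halting time
    \<open>t \<le> T\<close>, and its prefix up to \<open>t\<close> lies in \<open>D\<close>; the
    union bound then compares with the sum of \<open>h\<close>.\<close>
  have "measure_pmf.prob (history V P w T) {cs. halted V (fst (last cs))}
      \<le> measure_pmf.prob (history V P w T) (\<Union>t\<in>{..T}. {cs. take (Suc t) cs \<in> D})"
  proof (rule measure_pmf.finite_measure_mono_AE)
    have "\<exists>t\<le>T. take (Suc t) cs \<in> D"
      if cs: "cs \<in> set_pmf (history V P w T)" "halted V (fst (last cs))" for cs
    proof -
      have len: "length cs = Suc T" using cs length_history by blast
      then have "halted V (fst (cs ! T))" using cs by (simp add: last_conv_nth flip: length_0_conv)
      then obtain t where t: "halted V (fst (cs ! t))" "\<And>u. u < t \<Longrightarrow> \<not> halted V (fst (cs ! u))" "t \<le> T"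
        using exists_least_iff[of "\<lambda>t. halted V (fst (cs ! t))"] by (metis not_le)
      have "butlast (take (Suc t) cs) = take t cs" using t len by (simp add: butlast_take)
      moreover have "last (take (Suc t) cs) = cs ! t" using t len by (simp add: take_Suc_conv_app_nth)
      moreover have "\<forall>c\<in>set (take t cs). \<not> halted V (fst c)"
        using t(2) by (fastforce simp: in_set_conv_nth)
      ultimately have "take (Suc t) cs \<in> D" using t(1) by (simp add: D_def)
      then show ?thesis using t(3) by blast
    qed
    then show "AE cs in measure_pmf (history V P w T). cs \<in> {cs. halted V (fst (last cs))}
        \<longrightarrow> cs \<in> (\<Union>t\<in>{..T}. {cs. take (Suc t) cs \<in> D})"
      by (auto simp: AE_measure_pmf_iff)
  qed simp
  also have "\<dots> \<le> (\<Sum>t\<le>T. measure_pmf.prob (history V P w T) {cs. take (Suc t) cs \<in> D})"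
    by (rule measure_pmf.finite_measure_subadditive_finite) auto
  also have "\<dots> = (\<Sum>t\<le>T. h t)" using early by simp
  finally have "p \<le> (\<Sum>t\<le>T. h t)" using assms by linarith
  moreover have "h sums (\<Sum>t\<le>T. h t)" "(\<lambda>t. real t * h t) sums (\<Sum>t\<le>T. real t * h t)"
    by (rule sums_finite; simp add: late)+
  moreover have "(\<Sum>t\<le>T. real t * h t) \<le> real T * (\<Sum>t\<le>T. h t)"
    unfolding sum_distrib_left by (intro sum_mono mult_right_mono) (auto simp: h0)
  ultimately show ?thesis
    unfolding halts_within_expected_def h_def by blast
qed

section \<open>The protocol\<close>

text \<open>The truthful supply is one of the arbitrary ones, so the trajectory of head
  \<open>i\<close> in the run of \<open>M\<close> itself is a prefix of that of \<open>N\<close>.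
  Comparing lengths and entries gives the two claims about \<open>m\<close>.\<close>

lemma supersafe_guide:
  fixes M :: "(bool, 'a) mhdfa"
  assumes "supersafe M i"
  shows "\<exists>N :: (unit, 'a) mhdfa. wf_mhdfa N \<and>
    (\<forall>w. \<exists>n m. first_time (\<lambda>t. fst (mh_run N w t) \<in> halting N) n \<and>
      first_time (\<lambda>t. fst (mh_run M w t) \<in> halting M) m \<and> m \<le> n \<and>
      (\<forall>t\<le>m. snd (mh_run M w t) i = snd (mh_run N w t) ()))"
proof -
  obtain N :: "(unit, 'a) mhdfa" where wf: "wf_mhdfa N" and N: "\<And>w. \<exists>n.
      first_time (\<lambda>t. fst (mh_run N w t) \<in> halting N) n \<and>
      (\<forall>s. \<exists>m. first_time (\<lambda>t. fst (sim_run M i w s t) \<in> halting M) m \<and>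
        prefix (map (\<lambda>t. snd (sim_run M i w s t)) [0..<Suc m])
          (map (\<lambda>t. snd (mh_run N w t) ()) [0..<Suc n]))"
    using assms unfolding supersafe_def by auto
  have "\<exists>n m. first_time (\<lambda>t. fst (mh_run N w t) \<in> halting N) n \<and>
      first_time (\<lambda>t. fst (mh_run M w t) \<in> halting M) m \<and> m \<le> n \<and>
      (\<forall>t\<le>m. snd (mh_run M w t) i = snd (mh_run N w t) ())" for w
  proof -
    obtain n where n: "first_time (\<lambda>t. fst (mh_run N w t) \<in> halting N) n"
      and *: "\<forall>s. \<exists>m. first_time (\<lambda>t. fst (sim_run M i w s t) \<in> halting M) m \<and>
        prefix (map (\<lambda>t. snd (sim_run M i w s t)) [0..<Suc m])
          (map (\<lambda>t. snd (mh_run N w t) ()) [0..<Suc n])"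
      using N by blast
    obtain m where m: "first_time (\<lambda>t. fst (mh_run M w t) \<in> halting M) m"
      and pre: "prefix (map (\<lambda>t. snd (mh_run M w t) i) [0..<Suc m])
          (map (\<lambda>t. snd (mh_run N w t) ()) [0..<Suc n])"
      using *[rule_format, of "\<lambda>t. scan w (snd (mh_run M w t) (\<not> i))"]
      unfolding sim_run_truthful fst_conv snd_conv by blast
    have "m \<le> n" using prefix_length_le[OF pre] by simp
    moreover have "snd (mh_run M w t) i = snd (mh_run N w t) ()" if "t \<le> m" for t
    proof -
      obtain zs where zs: "map (\<lambda>t. snd (mh_run N w t) ()) [0..<Suc n]
          = map (\<lambda>t. snd (mh_run M w t) i) [0..<Suc m] @ zs"
        using pre by (auto simp only: prefix_def)
      have "map (\<lambda>t. snd (mh_run N w t) ()) [0..<Suc n] ! t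
          = map (\<lambda>t. snd (mh_run M w t) i) [0..<Suc m] ! t"
        unfolding zs using that by (subst nth_append) (simp del: upt_Suc)
      then show ?thesis using that \<open>m \<le> n\<close> by (simp del: upt_Suc)
    qed
    ultimately show ?thesis using n m by blast
  qed
  then show ?thesis using wf by blast
qed

text \<open>In state \<open>h0\<close> prover and verifier begin as if a round had just ended, so
  the first step is already a coin toss. The number \<open>d\<close> fixes the bias, and
  \<open>code\<close> represents tape symbols as messages.\<close>

locale head_protocol =
  fixes M :: "(bool, 'a) mhdfa" and N :: "(unit, 'a) mhdfa" and i :: bool
    and d h0 G :: nat and code :: "'a tsym \<Rightarrow> nat"
  assumes wfM: "wf_mhdfa M" and wfN: "wf_mhdfa N"
    and guide: "\<And>w. \<exists>n m. first_time (\<lambda>t. fst (mh_run N w t) \<in> halting N) n \<and>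
      first_time (\<lambda>t. fst (mh_run M w t) \<in> halting M) m \<and> m \<le> n \<and>
      (\<forall>t\<le>m. snd (mh_run M w t) i = snd (mh_run N w t) ())"
    and h0: "h0 \<in> halting N"
    and inj_code: "inj code" and code_less: "\<And>x. code x < G"
begin

definition p :: real where "p = 1 / (real d + 1)"

definition acc :: nat where "acc = nstates M + nstates N"

definition rej :: nat where "rej = nstates M + nstates N + 1"

text \<open>Replacing a halting state of \<open>M\<close> on entry, not one step later, lets the
  simulation end no later than the run of \<open>N\<close>; it also covers a halting
  \<open>start M\<close>.\<close>

definition enter :: "nat \<Rightarrow> nat" where
  "enter q = (if q \<in> accepting M then acc else if q \<in> rejecting M then rej else q)"

text \<open>Once \<open>N\<close> has halted, the head walks left in that same state and restarts at
  the left endmarker, so repetition costs no extra memory. The restart takes one step in place, in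
  which the verifier tosses.\<close>

definition cycle :: "nat \<Rightarrow> 'a tsym \<Rightarrow> nat \<times> int" where
  "cycle q x =
     (if q \<in> halting N then if x = LEnd then (start N, 0) else (q, -1)
      else (fst (delta N q (\<lambda>_. x)), snd (delta N q (\<lambda>_. x)) ()))"

text \<open>A state below \<open>nstates M\<close> simulates \<open>M\<close> with the head other than \<open>i\<close>, taking the
  symbols of head \<open>i\<close> from the prover; a state \<open>nstates M + q\<close> follows \<open>cycle\<close> in state \<open>q\<close>
  and compares the prover's symbols with its own.  Each cycle starts with a toss of the coin.\<close>

definition vnext :: "nat \<Rightarrow> 'a tsym \<Rightarrow> nat option \<Rightarrow> bool \<Rightarrow> nat \<times> int" where
  "vnext q x m coin =
     (if q < nstates M then
        (enter (fst (delta M q (\<lambda>h. if h = i then inv_into UNIV code (the m) else x))),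
         snd (delta M q (\<lambda>h. if h = i then inv_into UNIV code (the m) else x)) (\<not> i))
      else if q < nstates M + nstates N then
        if q - nstates M \<in> halting N then
          if x = LEnd \<and> coin then (enter (start M), 0)
          else apfst ((+) (nstates M)) (cycle (q - nstates M) x)
        else if m = Some (code x) then apfst ((+) (nstates M)) (cycle (q - nstates M) x)
        else (rej, 0)
      else (q, 0))"

text \<open>Every state sends the same message, so the messages do not reveal the mode. A coin is
  drawn in every step, but \<open>vnext\<close> consults it only at the restart of a round.\<close>

definition V :: "'a verifier" where
  "V = \<lparr>pstates = nstates M + nstates N + 2, psyms = 1, pstart = nstates M + h0,
        ptrans = \<lambda>q x s m. map_pmf (\<lambda>coin. (fst (vnext q x m coin), 0, snd (vnext q x m coin), 0, ()))
                   (bernoulli_pmf p),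
        gamma = G, message = \<lambda>_. Some 0, accept = acc, reject = rej\<rparr>"

definition reply :: "'a tsym \<Rightarrow> nat option \<Rightarrow> nat option" where
  "reply x m = map_option (\<lambda>_. code x) m"

definition cprover :: "('a, nat option) ptm" where
  "cprover = \<lparr>pstates = nstates N, psyms = 1, pstart = h0,
     ptrans = \<lambda>q x s m. return_pmf (fst (cycle q x), 0, snd (cycle q x), 0, reply x m)\<rparr>"

text \<open>A one-dimensional register under the identity stays idle, so this prover behaves like
  \<open>cprover\<close>.\<close>

definition qprover :: "'a qfa" where
  "qprover = \<lparr>qstates = nstates N, qstart = h0, qdim = 1, qop_of = \<lambda>q x m. Unitary (1\<^sub>m 1),
     qtrans = \<lambda>q x m k. (fst (cycle q x), snd (cycle q x), reply x m)\<rparr>"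

section \<open>Well-formedness and constant work space of the machines\<close>

lemma p_bounds: "0 \<le> p" "p \<le> 1" by (auto simp: p_def)

lemma enter_less: "q < nstates M \<Longrightarrow> enter q < nstates M + nstates N + 2"
  by (simp add: enter_def acc_def rej_def)

lemma halting_less: "q \<in> halting M \<Longrightarrow> q < nstates M" "b \<in> halting N \<Longrightarrow> b < nstates N"
  using wfM wfN by (auto simp: wf_mhdfa_def halting_def)

lemma cycle_wf:
  assumes "b < nstates N"
  shows "fst (cycle b x) < nstates N" "legal_move x (snd (cycle b x))"
  using assms wfN by (auto simp: cycle_def wf_mhdfa_def legal_move_def)

lemma vnext_wf:
  assumes q: "q < nstates M + nstates N + 2"
  shows "fst (vnext q x m coin) < nstates M + nstates N + 2"
    "legal_move x (snd (vnext q x m coin))"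
proof -
  have stM: "start M < nstates M" using wfM by (simp add: wf_mhdfa_def)
  have dM: "fst (delta M q y) < nstates M \<and> legal_move (y h) (snd (delta M q y) h)"
    if "q < nstates M" for y h
    using wfM that by (simp add: wf_mhdfa_def)
  have dM': "legal_move x (snd (delta M q (\<lambda>h. if h = i then y else x)) (\<not> i))"
    if "q < nstates M" for y
    using dM[OF that, of "\<lambda>h. if h = i then y else x" "\<not> i"] by (simp split: if_splits)
  have C: "fst (cycle (q - nstates M) x) < nstates N" "legal_move x (snd (cycle (q - nstates M) x))"
    if "\<not> q < nstates M" "q < nstates M + nstates N"
    using that cycle_wf[of "q - nstates M" x] by simp_all
  have l0: "legal_move y 0" for y :: "'a tsym" by (simp add: legal_move_def)
  show "fst (vnext q x m coin) < nstates M + nstates N + 2"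
    using q C(1) dM enter_less stM by (simp add: vnext_def rej_def less_SucI)
  show "legal_move x (snd (vnext q x m coin))"
    using C dM' l0 by (simp add: vnext_def)
qed

lemma wf_V: "wf_verifier V"
proof -
  have "wf_ptm G (ptm.truncate V)"
    unfolding wf_ptm_def
  proof (intro conjI allI impI)
    show "pstart (ptm.truncate V) < pstates (ptm.truncate V)" "0 < psyms (ptm.truncate V)"
      using halting_less(2)[OF h0] by (simp_all add: V_def ptm.truncate_def)
  next
    fix q x s m a assume "q < pstates (ptm.truncate V)"
    then show "\<forall>(q', s', d, e, u)\<in>set_pmf (ptrans (ptm.truncate V) q x s m).
        q' < pstates (ptm.truncate V) \<and> s' < psyms (ptm.truncate V) \<and> legal_move x d \<and> e \<in> {-1, 0, 1}"
      using vnext_wf[of q x m] by (auto simp: V_def ptm.truncate_def)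
    show "computable_real (pmf (ptrans (ptm.truncate V) q x s m) a)"
      using computable_real_pmf_bernoulli by (simp add: V_def ptm.truncate_def p_def)
  qed
  \<comment> \<open>The constant message 0 must belong to the alphabet.\<close>
  moreover have "0 < G" using code_less[of LEnd] by simp
  ultimately show ?thesis
    by (simp add: wf_verifier_def V_def acc_def rej_def)
qed

lemma gamma_V [simp]: "gamma V = G" and accept_V [simp]: "accept V = acc"
  and reject_V [simp]: "reject V = rej"
  by (simp_all add: V_def)

lemma constant_space_ptm_no_work_move:
  assumes "\<And>q x s m q' s' d e u. (q', s', d, e, u) \<in> set_pmf (ptrans T q x s m) \<Longrightarrow> e = 0"
  shows "constant_space_ptm T A"
proof -
  have "fst (snd (snd c)) = 0" if "c \<in> ptm_reach T A w" for w c
    using that by induction (auto simp: ptm_init_def ptm_step_def dest!: assms split: prod.splits)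
  then show ?thesis unfolding constant_space_ptm_def by (intro exI[of _ 0]) fastforce
qed

lemma constant_space_V: "constant_space_verifier V"
  unfolding constant_space_verifier_def
  by (rule constant_space_ptm_no_work_move) (auto simp: V_def ptm.truncate_def)

lemma constant_space_cprover: "constant_space_prover G (Classical cprover)"
  by (simp, rule constant_space_ptm_no_work_move) (auto simp: cprover_def)

lemma reply_qwrites: "qwrites G m (reply x m)"
  using code_less by (auto simp: qwrites_def reply_def)

lemma wf_cprover: "wf_prover G (Classical cprover)"
proof -
  have "computable_real (pmf (return_pmf y) z)" for y z :: "nat \<times> nat \<times> int \<times> int \<times> nat option"
    using computable_real_0 computable_real_1 by (simp add: pmf_return indicator_def)
  then show ?thesis
    using cycle_wf halting_less(2)[OF h0] reply_qwrites
    by (simp add: wf_ptm_def cprover_def)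
qed

lemma wf_qprover: "wf_prover G (Quantum qprover)"
proof -
  have "computable_mat (1\<^sub>m 1)"
    using computable_real_0 computable_real_1 by (simp add: computable_mat_def)
  moreover have "mat_adjoint (1\<^sub>m 1 :: complex mat) = 1\<^sub>m 1"
    by (rule eq_matI) (auto simp: mat_adjoint_def mat_of_rows_def)
  ultimately show ?thesis
    using cycle_wf halting_less(2)[OF h0] reply_qwrites
    by (simp add: wf_qfa_def qprover_def)
qed

text \<open>All messages being equal, the prover's step function \<open>ps\<close> does not depend on the verifier.\<close>

primrec miss :: "('s \<Rightarrow> ('s \<times> nat option) pmf) \<Rightarrow> 'a list \<Rightarrow> nat set \<Rightarrow> nat \<Rightarrow> nat \<Rightarrow> int \<Rightarrow> 's \<Rightarrow> ennreal"
where
  "miss ps w Good 0 q x s = indicator (- Good) q"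
| "miss ps w Good (Suc T) q x s =
     (if q \<in> {acc, rej} then miss ps w Good T q x s
      else \<integral>\<^sup>+y. (if snd y = None then miss ps w Good T rej x (fst y)
                 else \<integral>\<^sup>+coin. miss ps w Good T (fst (vnext q (scan w x) (snd y) coin))
                                (x + snd (vnext q (scan w x) (snd y) coin)) (fst y)
                        \<partial>bernoulli_pmf p) \<partial>ps s)"

text \<open>First-step analysis. Work head and tape never influence \<open>vnext\<close>, so they do
  not occur on the right; the induction keeps them arbitrary because each step rewrites a
  cell.\<close>

lemma emeasure_run_miss:
  "emeasure (run V P w T ((q, x, j, tp), s)) {c. fst (fst c) \<notin> Good}
   = miss (prover_step P w (Some 0)) w Good T q x s"
proof (induction T arbitrary: q x j tp s)
  case 0
  show ?case by (simp add: indicator_def)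
next
  case (Suc T)
  show ?case
  proof (cases "q \<in> {acc, rej}")
    case True
    then have "istep V P w ((q, x, j, tp), s) = return_pmf ((q, x, j, tp), s)"
      by (auto simp: istep_def halted_def)
    then show ?thesis using True Suc by (simp add: bind_return_pmf)
  next
    case False
    have "istep V P w ((q, x, j, tp), s) = bind_pmf (prover_step P w (Some 0) s) (\<lambda>y.
        if snd y = None then return_pmf ((rej, x, j, tp), fst y)
        else map_pmf (\<lambda>coin. ((fst (vnext q (scan w x) (snd y) coin),
               x + snd (vnext q (scan w x) (snd y) coin), j, tp(j := 0)), fst y)) (bernoulli_pmf p))"
      using False
      by (simp add: istep_def halted_def Let_def V_def ptm_step_def map_pmf_comp ptm.truncate_def
          case_prod_unfold cong: if_cong)
    then show ?thesis
      using False by (simp add: Suc if_distrib[of "\<lambda>\<mu>. \<integral>\<^sup>+z. _ z \<partial>measure_pmf \<mu>"]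
          bind_assoc_pmf cong: if_cong nn_integral_cong)
  qed
qed

text \<open>Each of \<open>k\<close> rounds takes one step for the toss, at most
  \<open>nstates N * (length w + 2)\<close> steps of \<open>N\<close>, and at most
  \<open>length w + 1\<close> steps back.\<close>

definition deadline :: "nat \<Rightarrow> 'a list \<Rightarrow> nat" where
  "deadline k w = k * (1 + nstates N * (length w + 2) + (length w + 1))"

end

section \<open>Failure probability over one round and over several rounds\<close>

lemma nn_integral_pmf_le:
  fixes B :: ennreal
  assumes "\<And>y. y \<in> set_pmf \<mu> \<Longrightarrow> f y \<le> B"
  shows "(\<integral>\<^sup>+y. f y \<partial>measure_pmf \<mu>) \<le> B"
proof -
  have "(\<integral>\<^sup>+y. f y \<partial>measure_pmf \<mu>) \<le> (\<integral>\<^sup>+y. B \<partial>measure_pmf \<mu>)"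
    using assms by (intro nn_integral_mono_AE) (simp add: AE_measure_pmf_iff)
  then show ?thesis by simp
qed

text \<open>\<open>Inv q x s\<close> relates the prover configuration \<open>s\<close> to the state and position of \<open>cycle\<close>.
  Untruthful replies are harmless when the check that they fail leads to a good state.\<close>

locale protocol_round = head_protocol M N i d h0 G code
  for M :: "(bool, 'a) mhdfa" and N i d h0 G code +
  fixes w :: "'a list" and ps :: "'s \<Rightarrow> ('s \<times> nat option) pmf" and Good :: "nat set"
    and Inv :: "nat \<Rightarrow> int \<Rightarrow> 's \<Rightarrow> bool"
  assumes Good_subset: "Good \<subseteq> {acc, rej}"
    and answer_Good: "(if mh_accepts M w then acc else rej) \<in> Good"
    and Inv_reply: "Inv q x s \<Longrightarrow> (s', r) \<in> set_pmf (ps s) \<Longrightarrow>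
      rej \<in> Good \<or> r = Some (code (scan w x))"
    and Inv_step: "Inv q x s \<Longrightarrow> (s', r) \<in> set_pmf (ps s) \<Longrightarrow>
      Inv (fst (cycle q (scan w x))) (x + snd (cycle q (scan w x))) s'"
begin

abbreviation "F \<equiv> miss ps w Good"

text \<open>The integrand of \<open>miss\<close> for a fixed reply \<open>y\<close>, isolated so
  that the two modes can be compared reply by reply.\<close>

definition reply_miss :: "nat \<Rightarrow> nat \<Rightarrow> int \<Rightarrow> 's \<times> nat option \<Rightarrow> ennreal" where
  "reply_miss T q x y =
     (if snd y = None then F T rej x (fst y)
      else \<integral>\<^sup>+coin. F T (fst (vnext q (scan w x) (snd y) coin))
             (x + snd (vnext q (scan w x) (snd y) coin)) (fst y) \<partial>bernoulli_pmf p)"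

lemma F_Suc: "q \<notin> {acc, rej} \<Longrightarrow> F (Suc T) q x s = (\<integral>\<^sup>+y. reply_miss T q x y \<partial>ps s)"
  by (simp add: reply_miss_def)

lemma F_le_1: "F T q x s \<le> 1"
proof (induction T arbitrary: q x s)
  case (Suc T)
  then show ?case by (auto intro!: nn_integral_pmf_le)
qed (simp add: indicator_def)

lemma F_Good: "q \<in> Good \<Longrightarrow> F T q x s = 0"
  using Good_subset by (induction T arbitrary: x s) auto

lemma reply_miss_le_1: "reply_miss T q x y \<le> 1"
  unfolding reply_miss_def by (auto intro!: nn_integral_pmf_le F_le_1)

lemma reply_miss_None: "rej \<in> Good \<Longrightarrow> snd y = None \<Longrightarrow> reply_miss T q x y = 0"
  by (simp add: reply_miss_def F_Good)

lemma reply_miss_simulate: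
  assumes "q < nstates M" "snd y = Some (code (scan w (pos i)))"
    "delta M q (\<lambda>h. scan w (pos h)) = (q', e)"
  shows "reply_miss T q (pos (\<not> i)) y = F T (enter q') (pos (\<not> i) + e (\<not> i)) (fst y)"
proof -
  have "inv_into UNIV code (the (snd y)) = scan w (pos i)"
    using assms(2) inj_code by simp
  then have "vnext q (scan w (pos (\<not> i))) (snd y) coin = (enter q', e (\<not> i))" for coin
    by (simp only: vnext_def assms(1,3) two_heads if_True fst_conv snd_conv)
  then show ?thesis using assms(2) by (simp add: reply_miss_def)
qed

lemma reply_miss_check:
  assumes "b < nstates N" "b \<notin> halting N" "snd y = Some (code (scan w x))"
  shows "reply_miss T (nstates M + b) x y
    = F T (nstates M + fst (cycle b (scan w x))) (x + snd (cycle b (scan w x))) (fst y)"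
  using assms by (simp add: reply_miss_def vnext_def)

lemma reply_miss_lie:
  assumes "b < nstates N" "b \<notin> halting N" "snd y \<noteq> Some (code (scan w x))" "rej \<in> Good"
  shows "reply_miss T (nstates M + b) x y = 0"
  using assms by (simp add: reply_miss_def vnext_def F_Good)

text \<open>The walk back is unchecked: any answer, true or false, moves the verifier one cell
  left.\<close>

lemma reply_miss_return:
  assumes "b \<in> halting N" "scan w x \<noteq> LEnd" "snd y \<noteq> None"
  shows "reply_miss T (nstates M + b) x y = F T (nstates M + b) (x - 1) (fst y)"
  using assms halting_less(2)[OF assms(1)]
  by (cases "snd y") (simp_all add: reply_miss_def vnext_def cycle_def)

lemma reply_miss_toss:
  assumes "b \<in> halting N" "scan w x = LEnd" "snd y \<noteq> None"
  shows "reply_miss T (nstates M + b) x y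
    = ennreal p * F T (enter (start M)) x (fst y)
      + ennreal (1 - p) * F T (nstates M + start N) x (fst y)"
  using assms halting_less(2)[OF assms(1)] p_bounds
  by (cases "snd y") (simp_all add: reply_miss_def vnext_def cycle_def mult.commute)

lemma enter_halting_Good:
  assumes "fst (mh_run M w j) \<in> halting M"
  shows "enter (fst (mh_run M w j)) \<in> Good"
  using answer_Good assms mh_accepts_iff_halting_state[OF wfM assms]
  by (auto simp: enter_def halting_def)

lemma state_not_final: "b < nstates N \<Longrightarrow> nstates M + b \<notin> {acc, rej}"
  "q < nstates M \<Longrightarrow> q \<notin> {acc, rej}"
  by (auto simp: acc_def rej_def)

text \<open>The prover cannot tell the two modes apart, so both are averaged over the same reply: a
  truthful one advances both, an untruthful one makes the checking mode reject and costs at most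
  \<open>p\<close>.\<close>

lemma round_bound:
  fixes R :: nat and B :: ennreal
  assumes n: "first_time (\<lambda>t. fst (mh_run N w t) \<in> halting N) n"
    and m: "first_time (\<lambda>t. fst (mh_run M w t) \<in> halting M) m" "m \<le> n"
    and same: "\<forall>t\<le>m. snd (mh_run M w t) i = snd (mh_run N w t) ()"
    and B: "\<And>T s. R \<le> T \<Longrightarrow> Inv (fst (mh_run N w n)) (snd (mh_run N w n) ()) s \<Longrightarrow>
      ennreal (1 - p) * F T (nstates M + fst (mh_run N w n)) (snd (mh_run N w n) ()) s \<le> B"
    and pB: "ennreal p \<le> B"
    and "j \<le> n" "Inv (fst (mh_run N w j)) (snd (mh_run N w j) ()) s" "R + (n - j) \<le> T"
  shows "ennreal p * F T (enter (fst (mh_run M w j))) (snd (mh_run M w j) (\<not> i)) s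
    + ennreal (1 - p) * F T (nstates M + fst (mh_run N w j)) (snd (mh_run N w j) ()) s \<le> B"
  using assms(7-)
proof (induction j arbitrary: s T rule: inc_induct)
  case base
  \<comment> \<open>By time \<open>n\<close> also \<open>M\<close> has halted, so the simulating
    mode sits in a good state and contributes 0.\<close>
  have "fst (mh_run M w n) \<in> halting M"
    using mh_run_frozen[of M w m n] m by (simp add: first_time_def)
  then show ?case using B base by (simp add: F_Good enter_halting_Good)
next
  case (step j)
  obtain T' where T: "T = Suc T'" using step by (cases T) auto
  obtain q pos where qp: "mh_run M w j = (q, pos)" by fastforce
  obtain b posN where bp: "mh_run N w j = (b, posN)" by fastforce
  have b: "b < nstates N" "b \<notin> halting N"
    using mh_run_bounds[OF wfN, of w j] n step bp by (auto simp: first_time_def dest: spec[of _ j])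
  have eta: "(\<lambda>_. scan w (posN ())) = (\<lambda>h. scan w (posN h))" by simp
  have cyc: "mh_run N w (Suc j) = (fst (cycle b (scan w (posN ()))),
      \<lambda>_. posN () + snd (cycle b (scan w (posN ()))))"
    using b unfolding mh_run_Suc bp mh_step_def cycle_def eta by (auto split: prod.splits)
  let ?true = "\<lambda>y :: 's \<times> nat option. snd y = Some (code (scan w (posN ())))"
  \<comment> \<open>An untruthful reply costs the simulating mode at most 1 and the checking mode 0,
    hence at most \<open>p\<close> after weighting, which \<open>pB\<close> allows.\<close>
  define gA where "gA = (\<lambda>y. if ?true y then F T' (enter (fst (mh_run M w (Suc j))))
      (snd (mh_run M w (Suc j)) (\<not> i)) (fst y) else 1)"
  define gB where "gB = (\<lambda>y. if ?true y then F T' (nstates M + fst (mh_run N w (Suc j)))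
      (snd (mh_run N w (Suc j)) ()) (fst y) else 0)"
  have A: "F T (enter q) (pos (\<not> i)) s \<le> (\<integral>\<^sup>+y. gA y \<partial>ps s)"
  proof (cases "q \<in> halting M")
    case True
    then show ?thesis using enter_halting_Good[of j] by (simp add: qp F_Good)
  next
    case False
    have q: "q < nstates M" "enter q = q"
      using mh_run_bounds[OF wfM, of w j] False qp by (auto simp: enter_def halting_def)
    \<comment> \<open>While \<open>M\<close> runs, its head \<open>i\<close> stands where the guide
      stands, so a reply that passes the check is the symbol that the simulation needs.\<close>
    have "j < m"
      using False m(1) mh_run_frozen[of M w m j] qp by (metis first_time_def fst_conv not_le)
    then have pos: "pos i = posN ()" using same qp bp by (metis less_imp_le snd_conv)
    obtain q' e where e: "delta M q (\<lambda>h. scan w (pos h)) = (q', e)" by fastforce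
    have "mh_run M w (Suc j) = (q', \<lambda>h. pos h + e h)"
      using False e by (simp add: mh_run_Suc qp mh_step_def)
    then have "reply_miss T' q (pos (\<not> i)) y \<le> gA y" for y
      using reply_miss_simulate[OF q(1) _ e, of y T'] reply_miss_le_1 by (simp add: gA_def pos)
    then have "(\<integral>\<^sup>+y. reply_miss T' q (pos (\<not> i)) y \<partial>ps s) \<le> (\<integral>\<^sup>+y. gA y \<partial>ps s)"
      by (intro nn_integral_mono) auto
    then show ?thesis
      unfolding T q(2) F_Suc[OF state_not_final(2)[OF q(1)]] .
  qed
  have B: "F T (nstates M + b) (posN ()) s \<le> (\<integral>\<^sup>+y. gB y \<partial>ps s)"
    unfolding T F_Suc[OF state_not_final(1)[OF b(1)]]
  proof (rule nn_integral_mono_AE, unfold AE_measure_pmf_iff, rule ballI)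
    fix y assume y: "y \<in> set_pmf (ps s)"
    show "reply_miss T' (nstates M + b) (posN ()) y \<le> gB y"
    proof (cases "?true y")
      case True
      then show ?thesis using reply_miss_check[OF b, of y "posN ()" T'] by (simp add: gB_def cyc)
    next
      case False
      then have "rej \<in> Good"
        using Inv_reply[of b "posN ()" s "fst y" "snd y"] step.prems y bp by simp
      then show ?thesis using reply_miss_lie[OF b False] by simp
    qed
  qed
  have "ennreal p * F T (enter q) (pos (\<not> i)) s + ennreal (1 - p) * F T (nstates M + b) (posN ()) s
      \<le> ennreal p * (\<integral>\<^sup>+y. gA y \<partial>ps s) + ennreal (1 - p) * (\<integral>\<^sup>+y. gB y \<partial>ps s)"
    by (intro add_mono mult_left_mono A B) auto
  also have "\<dots> = (\<integral>\<^sup>+y. ennreal p * gA y + ennreal (1 - p) * gB y \<partial>ps s)"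
    by (simp add: nn_integral_add nn_integral_cmult)
  also have "\<dots> \<le> B"
  proof (rule nn_integral_pmf_le)
    fix y assume y: "y \<in> set_pmf (ps s)"
    show "ennreal p * gA y + ennreal (1 - p) * gB y \<le> B"
    proof (cases "?true y")
      case True
      have "Inv (fst (mh_run N w (Suc j))) (snd (mh_run N w (Suc j)) ()) (fst y)"
        using Inv_step[of b "posN ()" s "fst y" "snd y"] step.prems y bp cyc by simp
      then show ?thesis
        using step.IH[of "fst y" T'] step T True by (simp add: gA_def gB_def)
    next
      case False
      then show ?thesis using pB by (simp add: gA_def gB_def)
    qed
  qed
  finally show ?case by (simp add: qp bp)
qed

text \<open>Induction on the distance to the left endmarker. An answer keeps both machines in step;
  silence leads to \<open>rej\<close>, and \<open>Inv_reply\<close> permits silence only if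
  \<open>rej\<close> is good.\<close>

lemma return_bound:
  assumes b: "b \<in> halting N" and B: "\<And>T s. R \<le> T \<Longrightarrow> Inv b 0 s \<Longrightarrow> F T (nstates M + b) 0 s \<le> B"
    and "Inv b (int l) s" "R + l \<le> T"
  shows "F T (nstates M + b) (int l) s \<le> B"
  using assms(3,4)
proof (induction l arbitrary: s T)
  case 0
  then show ?case using B by simp
next
  case (Suc l)
  obtain T' where T: "T = Suc T'" using Suc by (cases T) auto
  have x: "scan w (int (Suc l)) \<noteq> LEnd" by (simp add: scan_def)
  have "(\<integral>\<^sup>+y. reply_miss T' (nstates M + b) (int (Suc l)) y \<partial>ps s) \<le> B"
  proof (rule nn_integral_pmf_le)
    fix y assume "y \<in> set_pmf (ps s)"
    then have y: "(fst y, snd y) \<in> set_pmf (ps s)" by simp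
    show "reply_miss T' (nstates M + b) (int (Suc l)) y \<le> B"
    proof (cases "snd y = None")
      case True
      then have "rej \<in> Good" using Inv_reply[OF Suc.prems(1) y] by simp
      then show ?thesis using True by (simp add: reply_miss_None)
    next
      case False
      have "Inv b (int l) (fst y)"
        using Inv_step[OF Suc.prems(1) y] b x by (simp add: cycle_def)
      then show ?thesis
        using Suc.IH[of "fst y" T'] Suc.prems(2) T reply_miss_return[OF b x False] by simp
    qed
  qed
  then show ?case
    unfolding T F_Suc[OF state_not_final(1)[OF halting_less(2)[OF b]]] .
qed

text \<open>Induction on the number of rounds. The toss produces the weighted sum that
  \<open>round_bound\<close> estimates; what the checking mode leaves at the end of the round is the
  bound for the remaining rounds, discounted by \<open>1 - p\<close>.\<close>

lemma toss_bound:
  assumes n: "first_time (\<lambda>t. fst (mh_run N w t) \<in> halting N) n"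
    and m: "first_time (\<lambda>t. fst (mh_run M w t) \<in> halting M) m" "m \<le> n"
    and same: "\<forall>t\<le>m. snd (mh_run M w t) i = snd (mh_run N w t) ()"
    and "b \<in> halting N" "Inv b 0 s" "k * (1 + n + (length w + 1)) \<le> T"
  shows "F T (nstates M + b) 0 s \<le> max (ennreal p) (ennreal ((1 - p) ^ k))"
  using assms(5-)
proof (induction k arbitrary: b s T)
  case 0
  then show ?case using F_le_1[of T "nstates M + b" 0 s] by (simp add: le_max_iff_disj)
next
  case (Suc k)
  let ?K = "1 + n + (length w + 1)"
  let ?B = "max (ennreal p) (ennreal ((1 - p) ^ k))"
  let ?B' = "max (ennreal p) (ennreal ((1 - p) ^ Suc k))"
  define l where "l = nat (snd (mh_run N w n) ())"
  have l: "snd (mh_run N w n) () = int l" "l \<le> length w + 1"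
    using mh_run_bounds[OF wfN, of w n] by (auto simp: l_def)
  have hn: "fst (mh_run N w n) \<in> halting N" using n by (simp add: first_time_def)
  \<comment> \<open>One unit of time goes to the toss; the rest covers the run of \<open>N\<close>,
    the longest walk back and \<open>k\<close> further rounds.\<close>
  obtain T' where T: "T = Suc T'" "k * ?K + (length w + 1) + n \<le> T'"
    using Suc.prems(3) by (cases T) auto
  have x: "scan w 0 = LEnd" by (simp add: scan_def)
  \<comment> \<open>Under the factor \<open>1 - p\<close> the first entry of the maximum stays below
    \<open>p\<close> and the second gains a power.\<close>
  have "ennreal (1 - p) * ennreal p \<le> ennreal p"
    using p_bounds by (simp flip: ennreal_mult add: ennreal_leI mult_left_le_one_le)
  moreover have "ennreal (1 - p) * ennreal ((1 - p) ^ k) = ennreal ((1 - p) ^ Suc k)"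
    using p_bounds by (simp flip: ennreal_mult)
  ultimately have shrink: "ennreal (1 - p) * ?B \<le> ?B'"
    by (cases "ennreal p \<le> ennreal ((1 - p) ^ k)") (simp_all only: max.absorb1 max.absorb2
        le_max_iff_disj linear not_le less_imp_le order_refl simp_thms)
  have ret: "ennreal (1 - p) * F U (nstates M + fst (mh_run N w n)) (snd (mh_run N w n) ()) s \<le> ?B'"
    if "k * ?K + (length w + 1) \<le> U" "Inv (fst (mh_run N w n)) (snd (mh_run N w n) ()) s" for U s
  proof -
    have "F U (nstates M + fst (mh_run N w n)) (int l) s \<le> ?B"
      using that l by (intro return_bound[OF hn, of "k * ?K"] Suc.IH[OF hn]) auto
    then show ?thesis
      unfolding l(1) by (rule order_trans[OF mult_left_mono shrink]) simp
  qed
  have "(\<integral>\<^sup>+y. reply_miss T' (nstates M + b) 0 y \<partial>ps s) \<le> ?B'"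
  proof (rule nn_integral_pmf_le)
    fix y assume "y \<in> set_pmf (ps s)"
    then have y: "(fst y, snd y) \<in> set_pmf (ps s)" by simp
    show "reply_miss T' (nstates M + b) 0 y \<le> ?B'"
    proof (cases "snd y = None")
      case True
      then have "rej \<in> Good" using Inv_reply[OF Suc.prems(2) y] by simp
      then show ?thesis using True by (simp add: reply_miss_None)
    next
      case False
      have "Inv (start N) 0 (fst y)"
        using Inv_step[OF Suc.prems(2) y] Suc.prems(1) x by (simp add: cycle_def)
      then show ?thesis
        using round_bound[OF n m same ret, where j = 0 and s = "fst y" and T = T'] T(2)
        by (simp add: reply_miss_toss[OF Suc.prems(1) x False])
    qed
  qed
  then show ?case
    unfolding T F_Suc[OF state_not_final(1)[OF halting_less(2)[OF Suc.prems(1)]]] .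
qed

lemma deadline_bound:
  assumes "Inv h0 0 s"
  shows "F (deadline k w) (nstates M + h0) 0 s \<le> max (ennreal p) (ennreal ((1 - p) ^ k))"
proof -
  obtain n m where n: "first_time (\<lambda>t. fst (mh_run N w t) \<in> halting N) n"
    and m: "first_time (\<lambda>t. fst (mh_run M w t) \<in> halting M) m" "m \<le> n"
      "\<forall>t\<le>m. snd (mh_run M w t) i = snd (mh_run N w t) ()"
    using guide by blast
  show ?thesis
    by (rule toss_bound[OF n m h0 assms])
      (use halting_time_bound[OF wfN n] in \<open>simp add: deadline_def\<close>)
qed

end

section \<open>Completeness, soundness and halting\<close>

context head_protocol
begin

text \<open>The initial configuration stands before a toss, so the bound for \<open>k\<close> rounds
  applies at once, and \<open>k\<close> is large enough for its maximum to be
  \<open>p\<close>.\<close>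

lemma good_prob:
  assumes round: "protocol_round M N i h0 G code w (prover_step P w (Some 0)) Good Inv"
    and init: "Inv h0 0 (prover_init P)" and k: "(1 - p) ^ k \<le> p"
  shows "1 - p \<le> measure_pmf.prob (history V P w (deadline k w)) {cs. fst (fst (last cs)) \<in> Good}"
proof -
  let ?\<mu> = "run V P w (deadline k w) (ptm_init (ptm.truncate V), prover_init P)"
  have init_conf: "(ptm_init (ptm.truncate V), prover_init P)
      = ((nstates M + h0, 0, 0, \<lambda>_. 0), prover_init P)"
    by (simp add: ptm_init_def V_def ptm.truncate_def)
  have "emeasure ?\<mu> {c. fst (fst c) \<notin> Good} \<le> max (ennreal p) (ennreal ((1 - p) ^ k))"
    unfolding init_conf emeasure_run_miss
    by (rule protocol_round.deadline_bound[OF round init])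
  also have "\<dots> \<le> ennreal p" using k by (simp add: ennreal_leI)
  finally have "measure_pmf.prob ?\<mu> {c. fst (fst c) \<notin> Good} \<le> p"
    using p_bounds by (simp add: measure_pmf.emeasure_eq_measure)
  moreover have "measure_pmf.prob ?\<mu> {c. fst (fst c) \<in> Good}
      = 1 - measure_pmf.prob ?\<mu> {c. fst (fst c) \<notin> Good}"
    by (subst measure_pmf.prob_compl[symmetric]) (auto simp: Compl_eq[symmetric] Collect_neg_eq)
  ultimately show ?thesis by (simp only: prob_history_last[where Q = "\<lambda>c. fst (fst c) \<in> Good"])
qed

text \<open>Once \<open>rej\<close> counts as good, every reply is admissible and the trivial
  invariant serves. Taking \<open>{rej}\<close> gives soundness, \<open>{acc, rej}\<close> gives
  halting.\<close>

lemma arbitrary_prover: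
  assumes "rej \<in> Good" "Good \<subseteq> {acc, rej}" "(if mh_accepts M w then acc else rej) \<in> Good"
  shows "protocol_round M N i h0 G code w ps Good (\<lambda>_ _ _. True)"
  by unfold_locales (use assms in auto)

text \<open>With \<open>acc\<close> alone good, every reply must be true, so \<open>Inv\<close> has
  to tie the prover to the current state and position of \<open>cycle\<close>.\<close>

lemma honest_prover:
  assumes "mh_accepts M w"
    and "\<And>q x s s' r. Inv q x s \<Longrightarrow> (s', r) \<in> set_pmf (ps s) \<Longrightarrow>
      r = Some (code (scan w x)) \<and>
      Inv (fst (cycle q (scan w x))) (x + snd (cycle q (scan w x))) s'"
  shows "protocol_round M N i h0 G code w ps {acc} Inv"
  by unfold_locales (use assms in auto)

lemma protocol_correct:
  assumes k: "(1 - p) ^ k \<le> p" and p: "p \<le> \<epsilon>"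
  shows "interactive_proof_system V (Classical cprover) {w. mh_accepts M w} \<epsilon>"
    "interactive_proof_system V (Quantum qprover) {w. mh_accepts M w} \<epsilon>"
    "halts_within_expected V P w (1 - \<epsilon>) (real (deadline k w))"
proof -
  have up: "measure_pmf.prob (history V P w n) {cs. fst (fst (last cs)) = q}
      \<le> (SUP n. measure_pmf.prob (history V P w n) {cs. fst (fst (last cs)) = q})" for P w n q
    by (rule cSUP_upper) (auto intro!: bdd_aboveI[of _ 1])
  have sound: "reject_prob V P w \<ge> 1 - \<epsilon>" if "\<not> mh_accepts M w" for P w
  proof -
    have "1 - p \<le> measure_pmf.prob (history V P w (deadline k w)) {cs. fst (fst (last cs)) \<in> {rej}}"
      by (rule good_prob[OF arbitrary_prover _ k]) (use that in auto)
    then show ?thesis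
      using up[of P w "deadline k w" rej] p by (simp add: reject_prob_def)
  qed
  have complete: "accept_prob V P' v \<ge> 1 - \<epsilon>"
    if "protocol_round M N i h0 G code v (prover_step P' v (Some 0)) {acc} I"
      "I h0 0 (prover_init P')" for P' v I
    using good_prob[OF that k] up[of P' v "deadline k v" acc] p by (simp add: accept_prob_def)
  have "accept_prob V (Classical cprover) w \<ge> 1 - \<epsilon>" if "mh_accepts M w" for w
  proof (rule complete[of w "Classical cprover" "\<lambda>q x s. \<exists>j tp. s = Inl (q, x, j, tp)"])
    show "protocol_round M N i h0 G code w (prover_step (Classical cprover) w (Some 0)) {acc}
        (\<lambda>q x s. \<exists>j tp. s = Inl (q, x, j, tp))"
      by (rule honest_prover[OF that]) (auto simp: ptm_step_def cprover_def reply_def)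
  qed (simp add: ptm_init_def cprover_def)
  then show "interactive_proof_system V (Classical cprover) {w. mh_accepts M w} \<epsilon>"
    using sound wf_V wf_cprover by (simp add: interactive_proof_system_def)
  have "accept_prob V (Quantum qprover) w \<ge> 1 - \<epsilon>" if "mh_accepts M w" for w
  proof (rule complete[of w "Quantum qprover" "\<lambda>q x s. \<exists>\<psi>. s = Inr (q, x, \<psi>)"])
    show "protocol_round M N i h0 G code w (prover_step (Quantum qprover) w (Some 0)) {acc}
        (\<lambda>q x s. \<exists>\<psi>. s = Inr (q, x, \<psi>))"
      by (rule honest_prover[OF that]) (auto simp: qfa_step_def qprover_def reply_def)
  qed (simp add: qfa_init_def qprover_def)
  then show "interactive_proof_system V (Quantum qprover) {w. mh_accepts M w} \<epsilon>"
    using sound wf_V wf_qprover by (simp add: interactive_proof_system_def)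
  have "1 - p \<le> measure_pmf.prob (history V P w (deadline k w)) {cs. fst (fst (last cs)) \<in> {acc, rej}}"
    by (rule good_prob[OF arbitrary_prover _ k]) auto
  then show "halts_within_expected V P w (1 - \<epsilon>) (real (deadline k w))"
    using p by (intro halts_within_expected_deadline) (simp add: halted_def)
qed

end

lemma finite_tsym: "finite (UNIV :: 'a::finite tsym set)"
proof -
  have "(UNIV :: 'a tsym set) = {LEnd, REnd} \<union> range Sym"
    by (auto intro: tsym.exhaust)
  then show ?thesis by (metis finite.emptyI finite.insertI finite_UnI finite_imageI finite)
qed

theorem theorem1:
  fixes L :: "'a::finite list set" and \<epsilon> :: real
  assumes "\<epsilon> > 0" and "L \<in> TwoDFA2s"
  shows "\<exists>V :: 'a verifier.
           constant_space_verifier V \<and>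
           (\<exists>T. constant_space_prover (gamma V) (Classical T) \<and>
                interactive_proof_system V (Classical T) L \<epsilon>) \<and>
           (\<exists>Q. constant_space_prover (gamma V) (Quantum Q) \<and>
                interactive_proof_system V (Quantum Q) L \<epsilon>) \<and>
           (\<exists>p :: real poly. \<forall>w P. wf_prover (gamma V) P \<longrightarrow>
                halts_within_expected V P w (1 - \<epsilon>) (poly p (real (length w))))"
proof -
  obtain M :: "(bool, 'a) mhdfa" and i where M: "wf_mhdfa M" "supersafe M i"
    and L: "L = {w. mh_accepts M w}"
    using assms(2) by (auto simp: TwoDFA2s_def)
  obtain N :: "(unit, 'a) mhdfa" where N: "wf_mhdfa N"
    "\<And>w. \<exists>n m. first_time (\<lambda>t. fst (mh_run N w t) \<in> halting N) n \<and>
      first_time (\<lambda>t. fst (mh_run M w t) \<in> halting M) m \<and> m \<le> n \<and>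
      (\<forall>t\<le>m. snd (mh_run M w t) i = snd (mh_run N w t) ())"
    using supersafe_guide[OF M(2)] by blast
  obtain h0 where h0: "h0 \<in> halting N" using N(2)[of "[]"] by (auto simp: first_time_def)
  obtain code :: "'a tsym \<Rightarrow> nat" and G where code: "inj code" "code ` UNIV = {i. i < G}"
    using finite_imp_inj_to_nat_seg[OF finite_tsym] by metis
  \<comment> \<open>This choice makes the bias at most \<epsilon> while keeping it positive and
    rational.\<close>
  obtain d :: nat where d: "1 / \<epsilon> < real d" using reals_Archimedean2 by blast
  interpret head_protocol M N i d h0 G code
    by unfold_locales (use M(1) N h0 code in auto)
  have "1 < \<epsilon> * real d" using d assms(1) by (simp add: field_simps)
  then have p_le: "p \<le> \<epsilon>" unfolding p_def using assms(1) by (simp add: field_simps)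
  have "0 < p" by (simp add: p_def)
  \<comment> \<open>The number of rounds depends on \<open>p\<close> alone and not on the input,
    which keeps the deadline linear.\<close>
  then obtain k where "(1 - p) ^ k < p" using real_arch_pow_inv[of p "1 - p"] by auto
  then have k: "(1 - p) ^ k \<le> p" by simp
  \<comment> \<open>The coefficients come from multiplying out \<open>deadline k w\<close> in powers
    of \<open>length w\<close>.\<close>
  define q :: "real poly" where
    "q = [:real (k * (2 * nstates N + 2)), real (k * (nstates N + 1)):]"
  have "poly q (real (length w)) = real (deadline k w)" for w
    by (simp add: q_def deadline_def algebra_simps)
  then have "halts_within_expected V P w (1 - \<epsilon>) (poly q (real (length w)))" for w P
    using protocol_correct(3)[OF k p_le] by metis
  then show ?thesis
    using constant_space_V constant_space_cprover protocol_correct(1,2)[OF k p_le]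
    by (intro exI[of _ V] conjI exI[of _ cprover] exI[of _ qprover] exI[of _ q]) (simp_all add: L)
qed

end
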